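(* In the secretary problem with values in $[0,1]$, no best-only pricing curve achieves worst-case regret less than $0.171$; that is, for every threshold function $f:[0,1]\to[0,1]$ the corresponding best-only pricing curve satisfies $\sup_{\vec x}(x_1-\mathbb{E}[\mathsf{Alg}(\vec x)])\ge 0.171$.
   Context: Secretary problem: an adversary fixes $n$ values $1\ge x_1\ge\dots\ge x_n\ge 0$; each $x_i$ arrives at an independent uniform time $t_i\in[0,1]$; an online algorithm observes values in increasing arrival time, irrevocably decides whether to pick each, picks at most one, and obtains $0$ if it picks none. The regret is $\sup_{\vec x}(x_1-\mathbb{E}[\mathsf{Alg}(\vec x)])$ over all $n$ and all value vectors. A best-only pricing curve with threshold function $f$ picks the first arriving value $x_i$ such that both $x_i\ge f(t_i)$ and $x_i$ is the largest value arrived so far (ties broken by arbitrarily small noise). *)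

theory Defs
  imports "HOL-Probability.Probability"
begin

definition value_vector :: "nat \<Rightarrow> (nat \<Rightarrow> real) \<Rightarrow> bool" where
  "value_vector n x \<longleftrightarrow> n \<ge> 1 \<and> (\<forall>i\<in>{1..n}. 0 \<le> x i \<and> x i \<le> 1) \<and>
     (\<forall>i\<in>{1..n}. \<forall>j\<in>{1..n}. i \<le> j \<longrightarrow> x j \<le> x i)"

text \<open>Each arrival time lives on Lebesgue measure rather than Borel measure on the unit
  interval, so that every Lebesgue measurable threshold function has a well-defined
  expected payoff.\<close>

definition arrival_times :: "nat \<Rightarrow> (nat \<Rightarrow> real) measure" where
  "arrival_times n = (\<Pi>\<^sub>M i\<in>{1..n}. lebesgue_on {0..1})"

text \<open>Breaking ties by infinitesimal noise means that equal values are compared through some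
  strict ranking that is independent of the arrival times. As the arrival times are
  exchangeable, the law of the payoff is the same for every such ranking; we use the one
  given by the index.\<close>

definition outranks :: "(nat \<Rightarrow> real) \<Rightarrow> nat \<Rightarrow> nat \<Rightarrow> bool" where
  "outranks x i j \<longleftrightarrow> x i > x j \<or> x i = x j \<and> i < j"

definition best_so_far :: "nat \<Rightarrow> (nat \<Rightarrow> real) \<Rightarrow> (nat \<Rightarrow> real) \<Rightarrow> nat \<Rightarrow> bool" where
  "best_so_far n x t i \<longleftrightarrow> (\<forall>j\<in>{1..n}. j \<noteq> i \<and> t j \<le> t i \<longrightarrow> outranks x i j)"

definition acceptable ::
    "(real \<Rightarrow> real) \<Rightarrow> nat \<Rightarrow> (nat \<Rightarrow> real) \<Rightarrow> (nat \<Rightarrow> real) \<Rightarrow> nat \<Rightarrow> bool" where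
  "acceptable f n x t i \<longleftrightarrow> i \<in> {1..n} \<and> x i \<ge> f (t i) \<and> best_so_far n x t i"

text \<open>The minimiser below is unique even when arrival times coincide, because two values
  arriving at the same time cannot both be the best so far.\<close>

definition best_only_payoff ::
    "(real \<Rightarrow> real) \<Rightarrow> nat \<Rightarrow> (nat \<Rightarrow> real) \<Rightarrow> (nat \<Rightarrow> real) \<Rightarrow> real" where
  "best_only_payoff f n x t =
     (if \<exists>i. acceptable f n x t i then x (ARG_MIN t i. acceptable f n x t i) else 0)"

text \<open>The argument \<open>alg n x t\<close> is the payoff on values \<open>x 1, \<dots>, x n\<close> with
  arrival times \<open>t 1, \<dots>, t n\<close>. For payoffs in the unit interval the supremum is over
  a nonempty set of reals bounded above by 1.\<close>

definition regret :: "(nat \<Rightarrow> (nat \<Rightarrow> real) \<Rightarrow> (nat \<Rightarrow> real) \<Rightarrow> real) \<Rightarrow> real" where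
  "regret alg = Sup {x 1 - (\<integral>t. alg n x t \<partial>arrival_times n) | n x. value_vector n x}"

end

theory Submission
  imports Defs
begin

text \<open>The adversary uses inputs with one value \<open>u\<close> and many copies of a smaller value
  \<open>w\<close>. Let \<open>E\<^sub>v\<close> be the set of times with \<open>f > v\<close>, and let \<open>r\<^sub>n(s)\<close> be the probability
  that none of \<open>n\<close> copies of \<open>w\<close> is picked before time \<open>s\<close>. The loss on this input is
  \<open>(u - w) (1 - \<integral>r\<^sub>n) + u \<integral>\<^bsub>E\<^sub>u\<^esub> r\<^sub>n\<close>.
  Conditioning on the arrival of the top-ranked copy gives
  \<open>r\<^sub>n\<^sub>+\<^sub>1(s) = (1 - s) r\<^sub>n(s) + \<integral>\<^bsub>E\<^sub>w \<inter> [0,s)\<^esub> r\<^sub>n\<close>, so once \<open>r\<^sub>n\<close> has nearly converged,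
  \<open>s r\<^sub>n(s)\<close> is at most about \<open>\<integral>\<^bsub>E\<^sub>w\<^esub> r\<^sub>n\<close>, and therefore
  \<open>\<integral>r\<^sub>n \<le> a + ln (1/a) \<integral>\<^bsub>E\<^sub>w\<^esub> r\<^sub>n\<close> up to a small error, for every \<open>a\<close>.
  Suppose the regret is below \<open>0.171\<close> and let
  \<open>w = 0.38\<close>, \<open>u = 0.59\<close>. The value \<open>w\<close> alone forces \<open>E\<^sub>w\<close> to be short, so \<open>w\<close> is often picked
  when there are many copies of it; then \<open>u\<close> together with copies of \<open>w\<close> forces \<open>E\<^sub>u\<close> to be so
  small that on \<open>1\<close> together with copies of \<open>u\<close> the curve picks \<open>u\<close> too often.\<close>

section \<open>Lebesgue measure on the unit interval\<close>

abbreviation unit_lebesgue :: "real measure" where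
  "unit_lebesgue \<equiv> lebesgue_on {0..1}"

lemma prob_space_unit_lebesgue: "prob_space unit_lebesgue"
  by (rule prob_space_restrict_space) auto

interpretation U: prob_space unit_lebesgue
  by (rule prob_space_unit_lebesgue)

interpretation UP: product_sigma_finite "\<lambda>_::nat. unit_lebesgue"
  by unfold_locales

lemma prob_space_PiM_unit_lebesgue: "prob_space (\<Pi>\<^sub>M i\<in>I. unit_lebesgue)" for I :: "nat set"
  by (rule prob_space_PiM) (rule prob_space_unit_lebesgue)

lemma borel_imp_sets_unit_lebesgue: "A \<in> sets borel \<Longrightarrow> {0..1} \<inter> A \<in> sets unit_lebesgue"
  by (simp add: sets_restrict_space)

lemma Ico_sets_unit_lebesgue: "0 \<le> s \<Longrightarrow> s' \<le> 1 \<Longrightarrow> {s..<s'} \<in> sets unit_lebesgue"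
  using borel_imp_sets_unit_lebesgue[of "{s..<s'}"]
    Int_absorb1[of "{s..<s'}" "{0..1}"] atLeastLessThan_subseteq_atLeastAtMost_iff[of s s' 0 1]
  by auto

lemma measurable_ident_unit_lebesgue [measurable]: "(\<lambda>x. x) \<in> borel_measurable unit_lebesgue"
  using id_borel_measurable_lebesgue_on by (simp add: id_def)

text \<open>Serves to get measurability of \<open>reject_prob\<close> from its monotonicity:
  \<open>- g\<close> is monotone, hence Borel, and every Borel set is Lebesgue measurable.\<close>

lemma antimono_on_imp_measurable_unit_lebesgue:
  fixes g :: "real \<Rightarrow> real"
  assumes "antimono_on {0..1} g"
  shows "g \<in> borel_measurable unit_lebesgue"
proof -
  have "mono_on {0..1} (\<lambda>x. - g x)"
    using assms by (auto simp: monotone_on_def)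
  then have "(\<lambda>x. - g x) \<in> borel_measurable (restrict_space borel {0..1})"
    by (rule borel_measurable_mono_on_fnc)
  then have "(\<lambda>x. - (- g x)) \<in> borel_measurable (restrict_space borel {0..1})"
    by (rule borel_measurable_uminus)
  then have "g \<in> borel_measurable (restrict_space lborel {0..1})"
    by (simp cong: measurable_cong_sets sets_restrict_space_cong)
  moreover have "sets (restrict_space lborel {0..1}) \<subseteq> sets unit_lebesgue"
    by (rule mono_restrict_space) auto
  ultimately show ?thesis
    by (rule borel_measurable_subalgebra[rotated 2]) (auto simp: space_restrict_space)
qed

lemma integrable_unit_lebesgue:
  fixes g :: "real \<Rightarrow> real"
  assumes "g \<in> borel_measurable unit_lebesgue" "\<And>s. s \<in> {0..1} \<Longrightarrow> \<bar>g s\<bar> \<le> B"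
  shows "integrable unit_lebesgue g"
  by (rule U.integrable_const_bound[of _ B]) (use assms in auto)

lemma measure_unit_lebesgue_Ico:
  assumes "0 \<le> s" "s \<le> s'" "s' \<le> 1"
  shows "measure unit_lebesgue ({s..<s'} \<inter> {0..1}) = s' - s"
proof -
  have "{s..<s'} \<inter> {0..1} = {s..<s'}" "{s..<s'} \<subseteq> {0..1}" using assms by auto
  then show ?thesis using assms by (subst measure_restrict_space) auto
qed

section \<open>Rejection probabilities and their recursion\<close>

text \<open>The probability that none of \<open>n\<close> equal values is picked before time \<open>s\<close> when exactly
  the arrivals at times in \<open>E\<close> are priced out; the recursion conditions on the arrival
  time of the top-ranked one, which hides all later ones.\<close>

fun reject_prob :: "real set \<Rightarrow> nat \<Rightarrow> real \<Rightarrow> real" where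
  "reject_prob E 0 s = 1"
| "reject_prob E (Suc n) s = (1 - s) * reject_prob E n s +
     (\<integral>z. indicator (E \<inter> {..<s}) z * reject_prob E n z \<partial>unit_lebesgue)"

lemma sets_unit_lebesgue_Int_lessThan:
  assumes "E \<in> sets unit_lebesgue"
  shows "E \<inter> {..<s} \<in> sets unit_lebesgue" "E \<inter> {s..<s'} \<in> sets unit_lebesgue"
proof -
  have "E \<subseteq> {0..1}" using sets.sets_into_space[OF assms] by simp
  then have "E \<inter> {..<s} = E \<inter> ({0..1} \<inter> {..<s})" "E \<inter> {s..<s'} = E \<inter> ({0..1} \<inter> {s..<s'})" by auto
  then show "E \<inter> {..<s} \<in> sets unit_lebesgue" "E \<inter> {s..<s'} \<in> sets unit_lebesgue"
    using assms by (auto intro!: sets.Int borel_imp_sets_unit_lebesgue)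
qed

text \<open>Bounds and antitonicity share one induction because antitonicity also supplies the
  measurability of the integrand in the recursion. Moving from \<open>s\<close> to \<open>s'\<close>
  raises the integral by at most \<open>(s' - s) * reject_prob E n s\<close>, and the shrinking
  factor \<open>1 - s\<close> takes at least as much away.\<close>

lemma reject_prob_bounds_antimono:
  assumes E: "E \<in> sets unit_lebesgue"
  shows "(\<forall>s\<in>{0..1}. 0 \<le> reject_prob E n s \<and> reject_prob E n s \<le> 1) \<and>
    antimono_on {0..1} (reject_prob E n)"
proof (induction n)
  case 0
  show ?case by (auto simp: monotone_on_def)
next
  case (Suc n)
  let ?r = "reject_prob E n"
  let ?J = "\<lambda>s. \<integral>z. indicator (E \<inter> {..<s}) z * ?r z \<partial>unit_lebesgue"
  have b: "0 \<le> ?r s" "?r s \<le> 1" if "s \<in> {0..1}" for s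
    using Suc that by auto
  have anti: "?r s' \<le> ?r s" if "s \<in> {0..1}" "s' \<in> {0..1}" "s \<le> s'" for s s'
    using Suc that by (auto simp: monotone_on_def)
  have [measurable]: "?r \<in> borel_measurable unit_lebesgue"
    by (rule antimono_on_imp_measurable_unit_lebesgue) (use Suc in simp)
  note [measurable] = sets_unit_lebesgue_Int_lessThan[OF E]
  have int: "integrable unit_lebesgue (\<lambda>z. indicator A z * ?r z)" if "A \<in> sets unit_lebesgue" for A
    by (rule integrable_unit_lebesgue[where B = 1]) (use that b in \<open>auto split: split_indicator\<close>)
  have J0: "?J 0 = 0"
    by (rule integral_eq_zero_AE) (auto intro!: AE_I2 split: split_indicator)
  have Jd: "0 \<le> ?J s' - ?J s" "?J s' - ?J s \<le> (s' - s) * ?r s"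
    if s: "0 \<le> s" "s \<le> s'" "s' \<le> 1" for s s'
  proof -
    have Im: "{s..<s'} \<in> sets unit_lebesgue"
      using s by (simp add: Ico_sets_unit_lebesgue)
    note sets_unit_lebesgue_Int_lessThan[OF E, simp]
    have "?J s' - ?J s = (\<integral>z. indicator (E \<inter> {..<s'}) z * ?r z - indicator (E \<inter> {..<s}) z * ?r z \<partial>unit_lebesgue)"
      by (rule Bochner_Integration.integral_diff[symmetric]) (simp_all add: int)
    also have "\<dots> = (\<integral>z. indicator (E \<inter> {s..<s'}) z * ?r z \<partial>unit_lebesgue)"
      by (rule Bochner_Integration.integral_cong) (use s in \<open>auto split: split_indicator\<close>)
    finally have eq: "?J s' - ?J s = (\<integral>z. indicator (E \<inter> {s..<s'}) z * ?r z \<partial>unit_lebesgue)" .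
    show "0 \<le> ?J s' - ?J s"
      unfolding eq by (rule integral_nonneg_AE) (auto intro!: AE_I2 b split: split_indicator)
    have "?J s' - ?J s \<le> (\<integral>z. indicator {s..<s'} z * ?r s \<partial>unit_lebesgue)"
      unfolding eq
    proof (rule integral_mono)
      show "integrable unit_lebesgue (\<lambda>z. indicator {s..<s'} z * ?r s)"
        by (rule integrable_unit_lebesgue[where B = 1]) (use Im b s in \<open>auto split: split_indicator\<close>)
      show "indicator (E \<inter> {s..<s'}) z * ?r z \<le> indicator {s..<s'} z * ?r s"
        if "z \<in> space unit_lebesgue" for z
        using that s anti[of s z] b[of s] by (cases "z \<in> {s..<s'}"; cases "z \<in> E") auto
    qed (simp add: int)
    also have "\<dots> = (s' - s) * ?r s"
      using measure_unit_lebesgue_Ico[OF s] by simp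
    finally show "?J s' - ?J s \<le> (s' - s) * ?r s" .
  qed
  have anti': "reject_prob E (Suc n) s' \<le> reject_prob E (Suc n) s"
    if s: "0 \<le> s" "s \<le> s'" "s' \<le> 1" for s s'
  proof -
    have "(1 - s') * ?r s' \<le> (1 - s') * ?r s"
      using s anti by (intro mult_left_mono) auto
    then show ?thesis
      using Jd(2)[OF s] by (simp add: algebra_simps)
  qed
  \<comment> \<open>Given antitonicity, the endpoints suffice: at 0 the integral vanishes, at 1 the
    other term does.\<close>
  have "reject_prob E (Suc n) 0 \<le> 1"
    using J0 b[of 0] by simp
  moreover have "0 \<le> reject_prob E (Suc n) 1"
    using J0 Jd(1)[of 0 1] by simp
  ultimately have "0 \<le> reject_prob E (Suc n) s \<and> reject_prob E (Suc n) s \<le> 1" if "s \<in> {0..1}" for s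
    using anti'[of 0 s] anti'[of s 1] that by (auto simp del: reject_prob.simps)
  moreover have "antimono_on {0..1} (reject_prob E (Suc n))"
    using anti' by (auto simp: monotone_on_def simp del: reject_prob.simps)
  ultimately show ?case by blast
qed

lemma
  assumes "E \<in> sets unit_lebesgue"
  shows reject_prob_nonneg: "s \<in> {0..1} \<Longrightarrow> 0 \<le> reject_prob E n s"
    and reject_prob_le_1: "s \<in> {0..1} \<Longrightarrow> reject_prob E n s \<le> 1"
    and reject_prob_measurable: "reject_prob E n \<in> borel_measurable unit_lebesgue"
  using reject_prob_bounds_antimono[OF assms, of n] antimono_on_imp_measurable_unit_lebesgue by auto

lemma integrable_reject_prob:
  assumes "E \<in> sets unit_lebesgue"
  shows "integrable unit_lebesgue (reject_prob E n)"
  by (rule integrable_unit_lebesgue[where B = 1])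
     (use assms in \<open>auto simp: reject_prob_nonneg reject_prob_le_1 reject_prob_measurable\<close>)

lemma integrable_indicator_reject_prob:
  assumes "E \<in> sets unit_lebesgue" "A \<in> sets unit_lebesgue"
  shows "integrable unit_lebesgue (\<lambda>z. indicator A z * reject_prob E n z)"
  by (rule integrable_unit_lebesgue[where B = 1])
     (use assms in \<open>auto intro!: borel_measurable_times reject_prob_measurable
       simp: reject_prob_nonneg reject_prob_le_1 split: split_indicator\<close>)

text \<open>The recursion is monotone in the previous function, so the inequality between the first
  two functions propagates. It makes the decrements usable as nonnegative error terms.\<close>

lemma reject_prob_Suc_le:
  assumes E: "E \<in> sets unit_lebesgue"
  shows "s \<in> {0..1} \<Longrightarrow> reject_prob E (Suc n) s \<le> reject_prob E n s"
proof (induction n arbitrary: s)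
  case 0
  show ?case
    using reject_prob_le_1[OF E 0, of 1] by simp
next
  case (Suc n)
  have "(\<integral>z. indicator (E \<inter> {..<s}) z * reject_prob E (Suc n) z \<partial>unit_lebesgue)
      \<le> (\<integral>z. indicator (E \<inter> {..<s}) z * reject_prob E n z \<partial>unit_lebesgue)"
    by (rule integral_mono[OF integrable_indicator_reject_prob[OF E] integrable_indicator_reject_prob[OF E]])
       (auto split: split_indicator simp del: reject_prob.simps
         intro: Suc sets_unit_lebesgue_Int_lessThan[OF E])
  moreover have "(1 - s) * reject_prob E (Suc n) s \<le> (1 - s) * reject_prob E n s"
    using Suc by (intro mult_left_mono) auto
  ultimately show ?case
    using reject_prob.simps(2)[of E "Suc n" s] reject_prob.simps(2)[of E n s] by linarith
qed

lemma reject_prob_mono: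
  assumes E: "E \<in> sets unit_lebesgue" "E' \<in> sets unit_lebesgue" and "E \<subseteq> E'"
  shows "s \<in> {0..1} \<Longrightarrow> reject_prob E n s \<le> reject_prob E' n s"
proof (induction n arbitrary: s)
  case (Suc n)
  have "(\<integral>z. indicator (E \<inter> {..<s}) z * reject_prob E n z \<partial>unit_lebesgue)
      \<le> (\<integral>z. indicator (E' \<inter> {..<s}) z * reject_prob E' n z \<partial>unit_lebesgue)"
    by (rule integral_mono[OF integrable_indicator_reject_prob[OF E(1)] integrable_indicator_reject_prob[OF E(2)]])
       (use \<open>E \<subseteq> E'\<close> in \<open>auto split: split_indicator simp: Suc.IH reject_prob_nonneg[OF E(2)]
         intro: sets_unit_lebesgue_Int_lessThan E\<close>)
  moreover have "(1 - s) * reject_prob E n s \<le> (1 - s) * reject_prob E' n s"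
    using Suc by (intro mult_left_mono) auto
  ultimately show ?case by simp
qed simp

lemma integral_inverse_unit_lebesgue:
  assumes a: "0 < a" "a \<le> 1"
  shows "integrable unit_lebesgue (\<lambda>s. indicator {a..} s / s)"
    and "(\<integral>s. indicator {a..} s / s \<partial>unit_lebesgue) = ln (1 / a)"
proof -
  let ?g = "\<lambda>s::real. 1 / s * indicator {a..1} s"
  have hb: "has_bochner_integral lborel ?g (ln 1 - ln a)"
    by (rule has_bochner_integral_FTC_Icc_real)
       (use a in \<open>auto intro!: derivative_eq_intros continuous_intros\<close>)
  have "has_bochner_integral lebesgue ?g (ln (1 / a))"
    using hb a by (auto simp: has_bochner_integral_iff integrable_completion integral_completion ln_div)
  moreover have "(\<lambda>s. indicator {0..1} s *\<^sub>R (indicator {a..} s / s)) = ?g"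
    using a by (auto simp: fun_eq_iff split: split_indicator)
  ultimately show "integrable unit_lebesgue (\<lambda>s. indicator {a..} s / s)"
    "(\<integral>s. indicator {a..} s / s \<partial>unit_lebesgue) = ln (1 / a)"
    by (auto simp: has_bochner_integral_iff integrable_restrict_space integral_restrict_space)
qed

text \<open>Below \<open>a\<close> the integrand is bounded by 1. Above \<open>a\<close> the
  recursion bounds \<open>s * reject_prob E n s\<close> by the integral over \<open>E\<close> plus
  the decrement at \<open>s\<close>; dividing by \<open>s\<close> and integrating
  \<open>1 / s\<close> over \<open>[a, 1]\<close> produces the logarithm. The last summand is small
  when \<open>n\<close> is chosen so that the integrals have nearly converged.\<close>

lemma integral_reject_prob_le:
  assumes E: "E \<in> sets unit_lebesgue" and a: "0 < a" "a \<le> 1"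
  shows "(\<integral>s. reject_prob E n s \<partial>unit_lebesgue) \<le>
    a + ln (1 / a) * (\<integral>s. indicator E s * reject_prob E n s \<partial>unit_lebesgue) +
    ((\<integral>s. reject_prob E n s \<partial>unit_lebesgue) - (\<integral>s. reject_prob E (Suc n) s \<partial>unit_lebesgue)) / a"
proof -
  define X where "X = (\<integral>s. indicator E s * reject_prob E n s \<partial>unit_lebesgue)"
  let ?r = "reject_prob E n" and ?r' = "reject_prob E (Suc n)"
  note [simp del] = reject_prob.simps
  note int = integrable_reject_prob[OF E]
  have am: "{0..<a} \<in> sets unit_lebesgue"
    using a by (simp add: Ico_sets_unit_lebesgue)
  have ai: "integrable unit_lebesgue (indicator {0..<a} :: real \<Rightarrow> real)"
    by (rule integrable_unit_lebesgue[where B = 1]) (use am in \<open>auto split: split_indicator\<close>)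
  have "?r s \<le> indicator {0..<a} s + X * (indicator {a..} s / s) + (?r s - ?r' s) / a"
    if s: "s \<in> {0..1}" for s
  proof (cases "s < a")
    case True
    have "0 \<le> (?r s - ?r' s) / a"
      using reject_prob_Suc_le[OF E s] a by simp
    then show ?thesis
      using True s reject_prob_le_1[OF E s, of n] by simp
  next
    case False
    have "(\<integral>z. indicator (E \<inter> {..<s}) z * ?r z \<partial>unit_lebesgue) \<le> X"
      unfolding X_def
      by (rule integral_mono[OF integrable_indicator_reject_prob[OF E] integrable_indicator_reject_prob[OF E]])
         (auto split: split_indicator simp: reject_prob_nonneg[OF E]
           intro: sets_unit_lebesgue_Int_lessThan E)
    then have "s * ?r s \<le> X + (?r s - ?r' s)"
      by (simp add: reject_prob.simps algebra_simps)
    then have "?r s \<le> X / s + (?r s - ?r' s) / s"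
      using False a by (simp add: field_simps)
    also have "(?r s - ?r' s) / s \<le> (?r s - ?r' s) / a"
      using False a reject_prob_Suc_le[OF E s, of n] by (intro divide_left_mono) auto
    finally show ?thesis
      using False by simp
  qed
  moreover have "has_bochner_integral unit_lebesgue
      (\<lambda>s. indicator {0..<a} s + X * (indicator {a..} s / s) + (?r s - ?r' s) / a)
      (a + X * ln (1 / a) + ((\<integral>s. ?r s \<partial>unit_lebesgue) - (\<integral>s. ?r' s \<partial>unit_lebesgue)) / a)"
  proof (intro has_bochner_integral_add has_bochner_integral_mult_right
      has_bochner_integral_divide_zero has_bochner_integral_diff)
    show "has_bochner_integral unit_lebesgue (indicator {0..<a}) a"
      using measure_unit_lebesgue_Ico[of 0 a] a ai by (simp add: has_bochner_integral_iff)
    show "has_bochner_integral unit_lebesgue (\<lambda>s. indicator {a..} s / s) (ln (1 / a))"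
      using integral_inverse_unit_lebesgue[OF a] by (simp add: has_bochner_integral_iff)
  qed (auto intro: has_bochner_integral_integrable int)
  ultimately show ?thesis
    using integral_mono[OF int[of n], of "\<lambda>s. indicator {0..<a} s + X * (indicator {a..} s / s) + (?r s - ?r' s) / a"]
    by (simp add: has_bochner_integral_iff X_def mult.commute)
qed


section \<open>The event that no copy is picked, and its probability\<close>

text \<open>Among equal values, the smaller index outranks, so a copy is best so far iff no copy of
  smaller index has arrived yet.\<close>

definition rejects_before :: "real set \<Rightarrow> nat set \<Rightarrow> real \<Rightarrow> (nat \<Rightarrow> real) \<Rightarrow> bool" where
  "rejects_before E I s t \<longleftrightarrow>
     (\<forall>j\<in>I. t j < s \<and> t j \<notin> E \<longrightarrow> (\<exists>i\<in>I. i < j \<and> t i \<le> t j))"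

text \<open>The index \<open>m\<close> outranks all of \<open>I\<close>. Arriving at
  \<open>y < s\<close>, it hides every copy arriving from \<open>y\<close> on, so only the copies
  before \<open>y\<close> still matter; arriving at \<open>s\<close> or later, it hides nothing that
  arrives before \<open>s\<close>.\<close>

lemma rejects_before_insert_min:
  assumes "\<forall>j\<in>I. m < j"
  shows "rejects_before E (insert m I) s (t(m := y)) \<longleftrightarrow>
    (if y < s then y \<in> E \<and> rejects_before E I y t else rejects_before E I s t)"
proof -
  have [simp]: "m \<notin> I" "\<And>j. j \<in> I \<Longrightarrow> j \<noteq> m" "\<And>j. j \<in> I \<Longrightarrow> \<not> j < m" "\<And>j. j \<in> I \<Longrightarrow> m < j"
    using assms by auto
  show ?thesis
  proof (cases "y < s")
    case True
    then show ?thesis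
      unfolding rejects_before_def by (simp add: ball_insert) (meson le_less_trans less_trans not_less)
  next
    case False
    then show ?thesis
      unfolding rejects_before_def by (simp add: ball_insert)
  qed
qed

text \<open>The deadline \<open>g\<close> may depend on \<open>t\<close> because it will be the
  random arrival time of the large value.\<close>

lemma rejects_before_measurable:
  assumes E: "E \<in> sets unit_lebesgue" and "finite I" "I \<subseteq> J"
    and g [measurable]: "g \<in> borel_measurable (\<Pi>\<^sub>M i\<in>J. unit_lebesgue)"
  shows "Measurable.pred (\<Pi>\<^sub>M i\<in>J. unit_lebesgue) (\<lambda>t. rejects_before E I (g t) t)"
proof -
  have comp: "(\<lambda>t. t i) \<in> measurable (\<Pi>\<^sub>M i\<in>J. unit_lebesgue) unit_lebesgue" if "i \<in> I" for i
    using that assms by (intro measurable_component_singleton) auto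
  have real: "(\<lambda>t. t i) \<in> borel_measurable (\<Pi>\<^sub>M i\<in>J. unit_lebesgue)" if "i \<in> I" for i
    using measurable_compose[OF comp[OF that] measurable_ident_unit_lebesgue] by simp
  have mem: "Measurable.pred (\<Pi>\<^sub>M i\<in>J. unit_lebesgue) (\<lambda>t. t i \<in> E)" if "i \<in> I" for i
    using pred_sets2[OF E comp[OF that]] .
  have le: "Measurable.pred (\<Pi>\<^sub>M i\<in>J. unit_lebesgue) (\<lambda>t. t i \<le> t j)" if "i \<in> I" "j \<in> I" for i j
    using borel_measurable_le[OF real[OF that(1)] real[OF that(2)]] by (simp add: pred_def)
  have less: "Measurable.pred (\<Pi>\<^sub>M i\<in>J. unit_lebesgue) (\<lambda>t. t j < g t)" if "j \<in> I" for j
    using borel_measurable_less[OF real[OF that] g] by (simp add: pred_def)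
  show ?thesis
    unfolding rejects_before_def
    by (intro pred_intros_finite(3,4) pred_intros_logic \<open>finite I\<close> le less mem; simp)
qed

text \<open>Fubini with the inserted coordinate outermost: its arrival time is held fixed while the
  others are averaged.\<close>

lemma integral_PiM_unit_lebesgue_insert:
  fixes f :: "(nat \<Rightarrow> real) \<Rightarrow> real"
  assumes I: "finite I" "m \<notin> I"
    and f: "f \<in> borel_measurable (\<Pi>\<^sub>M i\<in>insert m I. unit_lebesgue)"
    and bounded: "\<And>t. \<bar>f t\<bar> \<le> B"
  shows "(\<integral>t. f t \<partial>(\<Pi>\<^sub>M i\<in>insert m I. unit_lebesgue)) =
    (\<integral>y. (\<integral>t. f (t(m := y)) \<partial>(\<Pi>\<^sub>M i\<in>I. unit_lebesgue)) \<partial>unit_lebesgue)"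
proof -
  interpret P: prob_space "\<Pi>\<^sub>M i\<in>insert m I. unit_lebesgue"
    by (rule prob_space_PiM_unit_lebesgue)
  interpret Q: prob_space "\<Pi>\<^sub>M i\<in>I. unit_lebesgue"
    by (rule prob_space_PiM_unit_lebesgue)
  interpret QU: pair_prob_space "\<Pi>\<^sub>M i\<in>I. unit_lebesgue" unit_lebesgue
    by unfold_locales
  have "integrable (\<Pi>\<^sub>M i\<in>insert m I. unit_lebesgue) f"
    by (rule P.integrable_const_bound[of _ B]) (use f bounded in auto)
  then have "(\<integral>t. f t \<partial>(\<Pi>\<^sub>M i\<in>insert m I. unit_lebesgue)) =
    (\<integral>t. (\<integral>y. f (t(m := y)) \<partial>unit_lebesgue) \<partial>(\<Pi>\<^sub>M i\<in>I. unit_lebesgue))"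
    by (rule UP.product_integral_insert[OF I])
  also have "\<dots> = (\<integral>y. (\<integral>t. f (t(m := y)) \<partial>(\<Pi>\<^sub>M i\<in>I. unit_lebesgue)) \<partial>unit_lebesgue)"
  proof (rule QU.Fubini_integral[symmetric])
    have "(\<lambda>(t, y). f (t(m := y))) \<in> borel_measurable ((\<Pi>\<^sub>M i\<in>I. unit_lebesgue) \<Otimes>\<^sub>M unit_lebesgue)"
      using measurable_compose[OF measurable_add_dim f] by (simp add: case_prod_unfold)
    then show "integrable ((\<Pi>\<^sub>M i\<in>I. unit_lebesgue) \<Otimes>\<^sub>M unit_lebesgue) (\<lambda>(t, y). f (t(m := y)))"
      by (intro QU.P.integrable_const_bound[of _ B]) (use bounded in auto)
  qed
  finally show ?thesis .
qed

text \<open>Induction adds a new smallest index and integrates over its arrival time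
  \<open>y\<close>. The times \<open>y < s\<close> in \<open>E\<close> give the integral of the
  recursion; the times from \<open>s\<close> on have measure \<open>1 - s\<close> and give the other
  term.\<close>

lemma integral_rejects_before:
  assumes E: "E \<in> sets unit_lebesgue" and "finite I"
  shows "s \<in> {0..1} \<Longrightarrow>
    (\<integral>t. of_bool (rejects_before E I s t) \<partial>(\<Pi>\<^sub>M i\<in>I. unit_lebesgue)) = reject_prob E (card I) s"
  using \<open>finite I\<close>
proof (induction I arbitrary: s rule: finite_linorder_min_induct)
  case empty
  interpret P: prob_space "\<Pi>\<^sub>M i\<in>({}::nat set). unit_lebesgue"
    by (rule prob_space_PiM_unit_lebesgue)
  show ?case by (simp add: rejects_before_def P.prob_space)
next
  case (insert m I)
  let ?r = "reject_prob E (card I)"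
  interpret P: prob_space "\<Pi>\<^sub>M i\<in>I. unit_lebesgue"
    by (rule prob_space_PiM_unit_lebesgue)
  have m: "m \<notin> I" using insert by auto
  have meas: "(\<lambda>t. of_bool (rejects_before E (insert m I) s t) :: real)
      \<in> borel_measurable (\<Pi>\<^sub>M i\<in>insert m I. unit_lebesgue)"
    using rejects_before_measurable[OF E, of "insert m I" "insert m I" "\<lambda>_. s"] insert by simp
  have "(\<integral>t. (of_bool (rejects_before E (insert m I) s t) :: real) \<partial>(\<Pi>\<^sub>M i\<in>insert m I. unit_lebesgue)) =
    (\<integral>y. (\<integral>t. of_bool (rejects_before E (insert m I) s (t(m := y))) \<partial>(\<Pi>\<^sub>M i\<in>I. unit_lebesgue))
      \<partial>unit_lebesgue)"
    by (rule integral_PiM_unit_lebesgue_insert[where B = 1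
          and f = "\<lambda>t. of_bool (rejects_before E (insert m I) s t)"])
       (use insert.hyps m meas in auto)
  also have "\<dots> = (\<integral>y. indicator (E \<inter> {..<s}) y * ?r y + ?r s * indicator {s..1} y \<partial>unit_lebesgue)"
  proof (rule Bochner_Integration.integral_cong)
    fix y assume "y \<in> space unit_lebesgue"
    then have y: "y \<in> {0..1}" by simp
    show "(\<integral>t. of_bool (rejects_before E (insert m I) s (t(m := y))) \<partial>(\<Pi>\<^sub>M i\<in>I. unit_lebesgue)) =
      indicator (E \<inter> {..<s}) y * ?r y + ?r s * indicator {s..1} y"
      unfolding rejects_before_insert_min[OF insert.hyps(2)]
      using y insert.IH[OF y] insert.IH[OF insert.prems]
      by (cases "y < s"; cases "y \<in> E") (auto simp: not_less)
  qed simp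
  also have "\<dots> = (\<integral>y. indicator (E \<inter> {..<s}) y * ?r y \<partial>unit_lebesgue) + ?r s * (1 - s)"
  proof -
    have sub: "{s..1} \<subseteq> {0..1::real}" "{s..1} \<inter> {0..1} = {s..1}" "{0..1} \<inter> {s..1} = {s..1}"
      using insert.prems by auto
    have s: "{s..1} \<in> sets unit_lebesgue"
      using borel_imp_sets_unit_lebesgue[of "{s..1}", unfolded sub] by simp
    have "measure unit_lebesgue ({s..1} \<inter> {0..1}) = 1 - s"
      unfolding sub(2) using sub(1) insert.prems by (subst measure_restrict_space) auto
    moreover have "integrable unit_lebesgue (indicator {s..1} :: real \<Rightarrow> real)"
      by (rule integrable_unit_lebesgue[where B = 1]) (use s in \<open>auto split: split_indicator\<close>)
    ultimately have "has_bochner_integral unit_lebesgue (indicator {s..1}) (1 - s)"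
      by (simp add: has_bochner_integral_iff)
    then have "has_bochner_integral unit_lebesgue
        (\<lambda>y. indicator (E \<inter> {..<s}) y * ?r y + ?r s * indicator {s..1} y)
        ((\<integral>y. indicator (E \<inter> {..<s}) y * ?r y \<partial>unit_lebesgue) + ?r s * (1 - s))"
      by (intro has_bochner_integral_add has_bochner_integral_mult_right has_bochner_integral_integrable
          integrable_indicator_reject_prob[OF E] sets_unit_lebesgue_Int_lessThan[OF E])
    then show ?thesis by (simp add: has_bochner_integral_iff)
  qed
  also have "\<dots> = reject_prob E (card (insert m I)) s"
    using insert.hyps(1) m by (simp add: mult.commute)
  finally show ?case .
qed

section \<open>Payoff and regret on one large value with equal smaller ones\<close>

definition gap_vector :: "real \<Rightarrow> real \<Rightarrow> nat \<Rightarrow> real" where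
  "gap_vector u w i = (if i = 1 then u else w)"

lemma value_vector_gap_vector:
  "0 \<le> w \<Longrightarrow> w \<le> u \<Longrightarrow> u \<le> 1 \<Longrightarrow> value_vector (Suc k) (gap_vector u w)"
  by (auto simp: value_vector_def gap_vector_def)

lemma ARG_MIN_acceptable:
  assumes "acceptable f n x t j"
  defines "i \<equiv> (ARG_MIN t i. acceptable f n x t i)"
  shows "acceptable f n x t i" "t i \<le> t j"
proof -
  have "finite {i. acceptable f n x t i}"
    by (rule finite_subset[of _ "{1..n}"]) (auto simp: acceptable_def)
  then obtain k where "is_arg_min t (acceptable f n x t) k"
    using ex_is_arg_min_if_finite[of "{i. acceptable f n x t i}" t] assms(1) by auto
  then have "is_arg_min t (acceptable f n x t) i"
    unfolding i_def arg_min_def by (rule someI)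
  then show "acceptable f n x t i" "t i \<le> t j"
    using assms(1) by (auto simp: is_arg_min_def not_less)
qed

lemma best_only_payoff_nonneg:
  assumes "value_vector n x"
  shows "0 \<le> best_only_payoff f n x t"
  using ARG_MIN_acceptable(1)[of f n x t] assms
  by (auto simp: best_only_payoff_def acceptable_def value_vector_def)

lemma regret_best_only_ge:
  assumes "value_vector n x"
  shows "x 1 - (\<integral>t. best_only_payoff f n x t \<partial>arrival_times n) \<le> regret (best_only_payoff f)"
  unfolding regret_def
proof (rule cSup_upper)
  show "bdd_above {x 1 - (\<integral>t. best_only_payoff f n x t \<partial>arrival_times n) | n x. value_vector n x}"
  proof (rule bdd_aboveI[of _ 1], clarify)
    fix n x assume v: "value_vector n x"
    \<comment> \<open>This needs no integrability, since a non-integrable function has integral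
      0.\<close>
    have "0 \<le> (\<integral>t. best_only_payoff f n x t \<partial>arrival_times n)"
      using best_only_payoff_nonneg[OF v] by simp
    moreover have "x 1 \<le> 1" using v by (auto simp: value_vector_def)
    ultimately show "x 1 - (\<integral>t. best_only_payoff f n x t \<partial>arrival_times n) \<le> 1" by simp
  qed
qed (intro CollectI exI[of _ n] exI[of _ x] conjI refl assms)

definition price_above :: "(real \<Rightarrow> real) \<Rightarrow> real \<Rightarrow> real set" where
  "price_above f v = {s \<in> {0..1}. v < f s}"

lemma price_above_sets:
  "f \<in> borel_measurable unit_lebesgue \<Longrightarrow> price_above f v \<in> sets unit_lebesgue"
  using borel_measurable_iff_greater[of f unit_lebesgue] by (auto simp: price_above_def)

text \<open>The large value is best so far whenever it arrives, and no copy is from then on. So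
  either a copy is picked strictly before \<open>t 1\<close>, or the price at \<open>t 1\<close>
  alone decides between \<open>u\<close> and nothing.\<close>

lemma best_only_payoff_gap_vector:
  fixes k :: nat
  defines "I \<equiv> {2..Suc k}"
  assumes "w < u" and t: "\<And>j. j \<in> {1..Suc k} \<Longrightarrow> t j \<in> {0..1}"
  shows "best_only_payoff f (Suc k) (gap_vector u w) t =
    (if rejects_before (price_above f w) I (t 1) t
     then (if t 1 \<in> price_above f u then 0 else u) else w)"
proof -
  let ?acc = "acceptable f (Suc k) (gap_vector u w) t"
  have best: "?acc 1 \<longleftrightarrow> t 1 \<notin> price_above f u"
    using t[of 1] \<open>w < u\<close>
    by (auto simp: acceptable_def best_so_far_def outranks_def gap_vector_def price_above_def)
  have ranks: "{1..Suc k} = insert 1 I" by (auto simp: I_def)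
  have other: "?acc j \<longleftrightarrow> t j < t 1 \<and> t j \<notin> price_above f w \<and> (\<forall>i\<in>I. i < j \<longrightarrow> t j < t i)"
    if "j \<in> I" for j
  proof -
    have j: "j \<noteq> 1" "j \<in> {1..Suc k}" using that by (auto simp: I_def)
    have "\<not> outranks (gap_vector u w) j 1" "\<And>i. i \<in> I \<Longrightarrow> outranks (gap_vector u w) j i \<longleftrightarrow> j < i"
      using j \<open>w < u\<close> by (auto simp: outranks_def gap_vector_def I_def)
    \<comment> \<open>Only copies of smaller index can block \<open>j\<close>, and a tie in arrival
      time blocks it too.\<close>
    moreover have "(i \<noteq> j \<and> t i \<le> t j \<longrightarrow> j < i) \<longleftrightarrow> (i < j \<longrightarrow> t j < t i)" for i
      by (cases i j rule: linorder_cases) auto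
    ultimately have "best_so_far (Suc k) (gap_vector u w) t j \<longleftrightarrow>
        t j < t 1 \<and> (\<forall>i\<in>I. i < j \<longrightarrow> t j < t i)"
      unfolding best_so_far_def ranks using j(1) by (simp add: not_le)
    then show ?thesis
      using t[OF j(2)] j by (auto simp: acceptable_def gap_vector_def price_above_def)
  qed
  have rej: "rejects_before (price_above f w) I (t 1) t \<longleftrightarrow> (\<forall>j\<in>I. \<not> ?acc j)"
    unfolding rejects_before_def
  proof (rule ball_cong[OF refl])
    fix j assume "j \<in> I"
    have "(\<exists>i\<in>I. i < j \<and> t i \<le> t j) \<longleftrightarrow> \<not> (\<forall>i\<in>I. i < j \<longrightarrow> t j < t i)"
      by (simp add: not_less)
    then show "(t j < t 1 \<and> t j \<notin> price_above f w \<longrightarrow> (\<exists>i\<in>I. i < j \<and> t i \<le> t j)) \<longleftrightarrow> \<not> ?acc j"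
      unfolding other[OF \<open>j \<in> I\<close>] by argo
  qed
  have dom: "j = 1 \<or> j \<in> I" if "?acc j" for j
    using that unfolding acceptable_def ranks by blast
  show ?thesis
  proof (cases "rejects_before (price_above f w) I (t 1) t")
    case True
    then have only: "j = 1" if "?acc j" for j using dom[OF that] rej that by blast
    show ?thesis
    proof (cases "?acc 1")
      case acc: True
      then have "(ARG_MIN t i. ?acc i) = 1" using only[OF ARG_MIN_acceptable(1)] by blast
      then show ?thesis using True acc best by (auto simp: best_only_payoff_def gap_vector_def)
    next
      case False
      then have "\<not> (\<exists>i. ?acc i)" using only by blast
      then show ?thesis using True False best by (simp add: best_only_payoff_def)
    qed
  next
    case False
    then obtain j where j: "j \<in> I" "?acc j" using rej by blast
    then have "t j < t 1" using other by blast
    then have "t (ARG_MIN t i. ?acc i) < t 1" using ARG_MIN_acceptable(2)[OF j(2)] by linarith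
    then have "(ARG_MIN t i. ?acc i) \<noteq> 1" by auto
    then show ?thesis using False j by (auto simp: best_only_payoff_def gap_vector_def)
  qed
qed

text \<open>Given that the large value arrives at \<open>y\<close>, no copy has been picked with
  probability \<open>r y\<close>. The payoff is then \<open>u\<close>, or 0 if \<open>y\<close> lies
  in \<open>price_above f u\<close>; otherwise it is \<open>w\<close>. Averaging over
  \<open>y\<close> gives the loss.\<close>

lemma regret_ge_gap_vector:
  fixes k :: nat
  assumes f: "f \<in> borel_measurable unit_lebesgue" and uw: "0 \<le> w" "w < u" "u \<le> 1"
  defines "r \<equiv> reject_prob (price_above f w) k"
  shows "(u - w) * (1 - (\<integral>s. r s \<partial>unit_lebesgue)) +
      u * (\<integral>s. indicator (price_above f u) s * r s \<partial>unit_lebesgue) \<le> regret (best_only_payoff f)"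
proof -
  define I where "I = {2..Suc k}"
  define g where "g t = (if rejects_before (price_above f w) I (t 1) t
     then (if t 1 \<in> price_above f u then 0 else u) else w)" for t :: "nat \<Rightarrow> real"
  note Ew = price_above_sets[OF f, of w] and Eu = price_above_sets[OF f, of u]
  have I: "finite I" "1 \<notin> I" "card I = k" "insert 1 I = {1..Suc k}" by (auto simp: I_def)
  interpret P: prob_space "\<Pi>\<^sub>M i\<in>I. unit_lebesgue"
    by (rule prob_space_PiM_unit_lebesgue)
  have comp: "(\<lambda>t. t 1) \<in> measurable (\<Pi>\<^sub>M i\<in>insert 1 I. unit_lebesgue) unit_lebesgue"
    by (intro measurable_component_singleton) auto
  have comp': "(\<lambda>t. t 1) \<in> borel_measurable (\<Pi>\<^sub>M i\<in>insert 1 I. unit_lebesgue)"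
    using measurable_compose[OF comp measurable_ident_unit_lebesgue] by simp
  have [measurable]: "Measurable.pred (\<Pi>\<^sub>M i\<in>insert 1 I. unit_lebesgue) (\<lambda>t. t 1 \<in> price_above f u)"
    using comp Eu by measurable
  have [measurable]: "Measurable.pred (\<Pi>\<^sub>M i\<in>insert 1 I. unit_lebesgue)
      (\<lambda>t. rejects_before (price_above f w) I (t 1) t)"
    by (rule rejects_before_measurable[OF Ew]) (use I(1) comp' in auto)
  have meas: "g \<in> borel_measurable (\<Pi>\<^sub>M i\<in>insert 1 I. unit_lebesgue)"
    unfolding g_def by measurable
  have "(\<integral>t. best_only_payoff f (Suc k) (gap_vector u w) t \<partial>arrival_times (Suc k)) =
      (\<integral>t. g t \<partial>(\<Pi>\<^sub>M i\<in>insert 1 I. unit_lebesgue))"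
    unfolding arrival_times_def I(4)
  proof (rule Bochner_Integration.integral_cong)
    fix t assume "t \<in> space (\<Pi>\<^sub>M i\<in>{1..Suc k}. unit_lebesgue)"
    then have "t j \<in> {0..1}" if "j \<in> {1..Suc k}" for j
      using that by (auto simp: space_PiM PiE_iff)
    then show "best_only_payoff f (Suc k) (gap_vector u w) t = g t"
      unfolding g_def I_def by (rule best_only_payoff_gap_vector[OF uw(2)])
  qed simp
  also have "\<dots> = (\<integral>y. (\<integral>t. g (t(1 := y)) \<partial>(\<Pi>\<^sub>M i\<in>I. unit_lebesgue)) \<partial>unit_lebesgue)"
  proof (rule integral_PiM_unit_lebesgue_insert[where B = 1])
    show "\<bar>g t\<bar> \<le> 1" for t using uw by (auto simp: g_def)
  qed (rule I meas)+
  also have "\<dots> = (\<integral>y. w + ((u - w) * r y - u * (indicator (price_above f u) y * r y)) \<partial>unit_lebesgue)"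
  proof (rule Bochner_Integration.integral_cong)
    fix y assume "y \<in> space unit_lebesgue"
    then have y: "y \<in> {0..1}" by simp
    define R where "R t = (of_bool (rejects_before (price_above f w) I y t) :: real)" for t
    have pred: "Measurable.pred (\<Pi>\<^sub>M i\<in>I. unit_lebesgue) (\<lambda>t. rejects_before (price_above f w) I y t)"
      by (rule rejects_before_measurable[OF Ew]) (use I(1) in auto)
    have R: "R = (\<lambda>t. of_bool (rejects_before (price_above f w) I y t))"
      by (simp add: R_def fun_eq_iff)
    have "R \<in> borel_measurable (\<Pi>\<^sub>M i\<in>I. unit_lebesgue)"
      unfolding R using pred by measurable
    then have "integrable (\<Pi>\<^sub>M i\<in>I. unit_lebesgue) R"
      by (intro P.integrable_const_bound[of _ 1]) (auto simp: R_def)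
    then have hb: "has_bochner_integral (\<Pi>\<^sub>M i\<in>I. unit_lebesgue) R (r y)"
      using integral_rejects_before[OF Ew I(1) y] I(3) by (simp add: has_bochner_integral_iff r_def R)
    have upd: "rejects_before (price_above f w) I y (t(1 := y)) \<longleftrightarrow> rejects_before (price_above f w) I y t" for t
    proof -
      have "\<And>j. j \<in> I \<Longrightarrow> j \<noteq> 1" using I by auto
      then show ?thesis unfolding rejects_before_def by simp
    qed
    have "(\<lambda>t. g (t(1 := y))) = (\<lambda>t. w + (u - w - u * indicator (price_above f u) y) * R t)"
      by (auto simp: g_def upd R_def fun_eq_iff simp del: One_nat_def split: split_indicator)
    moreover have "has_bochner_integral (\<Pi>\<^sub>M i\<in>I. unit_lebesgue)
        (\<lambda>t. w + (u - w - u * indicator (price_above f u) y) * R t)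
        (w + (u - w - u * indicator (price_above f u) y) * r y)"
      by (intro has_bochner_integral_add has_bochner_integral_mult_right hb)
         (simp add: has_bochner_integral_iff P.prob_space)
    ultimately show "(\<integral>t. g (t(1 := y)) \<partial>(\<Pi>\<^sub>M i\<in>I. unit_lebesgue)) =
        w + ((u - w) * r y - u * (indicator (price_above f u) y * r y))"
      by (simp add: has_bochner_integral_iff algebra_simps)
  qed simp
  also have "\<dots> = w + ((u - w) * (\<integral>s. r s \<partial>unit_lebesgue)
      - u * (\<integral>s. indicator (price_above f u) s * r s \<partial>unit_lebesgue))"
  proof -
    have "has_bochner_integral unit_lebesgue
        (\<lambda>y. w + ((u - w) * r y - u * (indicator (price_above f u) y * r y)))
        (w + ((u - w) * (\<integral>s. r s \<partial>unit_lebesgue)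
      - u * (\<integral>s. indicator (price_above f u) s * r s \<partial>unit_lebesgue)))"
      unfolding r_def
      by (intro has_bochner_integral_add has_bochner_integral_diff has_bochner_integral_mult_right
          has_bochner_integral_integrable integrable_reject_prob integrable_indicator_reject_prob Ew Eu)
         (use U.prob_space in \<open>simp add: has_bochner_integral_iff\<close>)
    then show ?thesis by (simp add: has_bochner_integral_iff)
  qed
  finally have "(\<integral>t. best_only_payoff f (Suc k) (gap_vector u w) t \<partial>arrival_times (Suc k)) =
     w + ((u - w) * (\<integral>s. r s \<partial>unit_lebesgue)
      - u * (\<integral>s. indicator (price_above f u) s * r s \<partial>unit_lebesgue))" .
  then show ?thesis
    using regret_best_only_ge[OF value_vector_gap_vector[of w u k], of f] uw
    by (simp add: gap_vector_def algebra_simps)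
qed

section \<open>Choice of the number of copies, and the numerical contradiction\<close>

lemma exists_small_decrement:
  fixes D :: "nat \<Rightarrow> real"
  assumes "\<And>n. 0 \<le> D n" "0 < e"
  shows "\<exists>n. D n - D (Suc n) < e"
proof (rule ccontr)
  assume "\<not> ?thesis"
  then have step: "e \<le> D n - D (Suc n)" for n
    by (simp add: not_less)
  have le: "D n \<le> D 0 - real n * e" for n
  proof (induction n)
    case (Suc n)
    then show ?case using step[of n] by (simp add: algebra_simps)
  qed simp
  obtain n where "D 0 < real n * e" using ex_less_of_nat_mult[OF assms(2)] by blast
  then show False using assms(1)[of n] le[of n] by linarith
qed

theorem theorem4p3:
  fixes f :: "real \<Rightarrow> real"
  assumes "f \<in> {0..1} \<rightarrow> {0..1}"
    and "f \<in> borel_measurable (lebesgue_on {0..1})"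
  shows "regret (best_only_payoff f) \<ge> 0.171"
proof (rule ccontr)
  assume "\<not> ?thesis"
  then have R: "regret (best_only_payoff f) < 171 / 1000" by simp
  define Ew where "Ew = price_above f (38 / 100)"
  define Eu where "Eu = price_above f (59 / 100)"
  define Q where "Q E n = (\<integral>s. reject_prob E n s \<partial>unit_lebesgue)" for E n
  define X where "X E F n = (\<integral>s. indicator F s * reject_prob E n s \<partial>unit_lebesgue)" for E F n
  have E: "Ew \<in> sets unit_lebesgue" "Eu \<in> sets unit_lebesgue"
    unfolding Ew_def Eu_def using assms(2) by (simp_all add: price_above_sets)
  have sub: "Eu \<subseteq> Ew" by (auto simp: Ew_def Eu_def price_above_def)
  have Qnn: "0 \<le> Q E n" if "E \<in> sets unit_lebesgue" for E n
    unfolding Q_def by (rule integral_nonneg_AE) (auto intro!: AE_I2 reject_prob_nonneg that)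
  have Qdec: "Q E (Suc n) \<le> Q E n" if "E \<in> sets unit_lebesgue" for E n
    unfolding Q_def
    by (intro integral_mono integrable_reject_prob that reject_prob_Suc_le) auto
  \<comment> \<open>Applying the lemma to the sum yields one \<open>n\<close> for both sets: both
    decrements are nonnegative, so each is below 1/1000.\<close>
  obtain n where n: "(Q Ew n + Q Eu n) - (Q Ew (Suc n) + Q Eu (Suc n)) < 1 / 1000"
    using exists_small_decrement[of "\<lambda>n. Q Ew n + Q Eu n" "1 / 1000"] Qnn E by auto
  then have dw: "Q Ew n - Q Ew (Suc n) < 1 / 1000" and du: "Q Eu n - Q Eu (Suc n) < 1 / 1000"
    using Qdec[OF E(1), of n] Qdec[OF E(2), of n] by auto
  have Xnn: "0 \<le> X E F m" if "E \<in> sets unit_lebesgue" for E F m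
    unfolding X_def
    by (rule integral_nonneg_AE) (auto intro!: AE_I2 mult_nonneg_nonneg reject_prob_nonneg that)
  have loss: "(u - w) * (1 - Q (price_above f w) m) + u * X (price_above f w) (price_above f u) m < 171 / 1000"
    if "0 \<le> w" "w < u" "u \<le> 1" for u w m
    using regret_ge_gap_vector[OF assms(2) that, of m] R unfolding Q_def X_def by linarith
  have Q_le: "Q E n \<le> a + ln (1 / a) * X E E n + (Q E n - Q E (Suc n)) / a"
    if "E \<in> sets unit_lebesgue" "0 < a" "a \<le> 1" for E a
    using integral_reject_prob_le[OF that] unfolding Q_def X_def .
  have ln2: "ln (2::real) \<le> 25 / 36" by (rule ln2_le_25_over_36)
  have "ln (4::real) = 2 * ln 2" using ln_realpow[of "2::real" 2] by simp
  then have ln4: "ln (4::real) \<le> 25 / 18" using ln2 by simp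
  \<comment> \<open>With zero copies the rejection probability is 1, so the right-hand side is the
    measure of \<open>Ew\<close>. The bound on it below is 0.171 / 0.38 = 0.45.\<close>
  have "X Ew Ew n \<le> X (price_above f 0) Ew 0"
    unfolding X_def
    by (intro integral_mono integrable_indicator_reject_prob E price_above_sets assms(2))
       (auto simp: reject_prob_le_1[OF E(1)] split: split_indicator)
  also have "\<dots> \<le> 45 / 100"
    \<comment> \<open>zero copies of the value \<open>0\<close>: the input is the single value \<open>38 / 100\<close>\<close>
    using loss[of 0 "38 / 100" 0] U.prob_space by (simp add: Ew_def Q_def)
  finally have Xw: "X Ew Ew n \<le> 45 / 100" .
  \<comment> \<open>The expression \<open>a + ln (1 / a) * X\<close> is least at
    \<open>a = X\<close>; here \<open>a = 1 / 2\<close> is a convenient value near 0.45. The total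
    is 0.5 + 0.3125 + 0.002.\<close>
  have "ln 2 * X Ew Ew n \<le> 25 / 36 * (45 / 100)"
    using Xw ln2 Xnn[OF E(1)] by (intro mult_mono) auto
  then have Qw: "Q Ew n \<le> 8145 / 10000"
    using Q_le[OF E(1), of "1 / 2"] dw by simp
  \<comment> \<open>Copies of 0.59 are refused at fewer times than copies of 0.38, so they are less
    likely to be all rejected.\<close>
  have "X Eu Eu n \<le> X Ew Eu n"
    unfolding X_def
    by (intro integral_mono integrable_indicator_reject_prob E)
       (auto intro!: mult_left_mono reject_prob_mono[OF E(2,1) sub])
  also have "\<dots> \<le> 224 / 1000"
  proof -
    \<comment> \<open>The input is 0.59 with \<open>n\<close> copies of 0.38. The first term is at
      least 0.21 * 0.1855 = 0.038955, leaving less than 0.132045 / 0.59 < 0.224 for the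
      integral.\<close>
    have "(59 / 100 - 38 / 100) * (1 - Q Ew n) + 59 / 100 * X Ew Eu n < 171 / 1000"
      unfolding Ew_def Eu_def by (rule loss) auto
    then show ?thesis using Qw by argo
  qed
  finally have Xu: "X Eu Eu n \<le> 224 / 1000" .
  \<comment> \<open>Now \<open>a = 1 / 4\<close> is near 0.224, and the error term is below
    4/1000.\<close>
  have "ln 4 * X Eu Eu n \<le> 25 / 18 * (224 / 1000)"
    using Xu ln4 Xnn[OF E(2)] by (intro mult_mono) auto
  then have "Q Eu n \<le> 57 / 100"
    using Q_le[OF E(2), of "1 / 4"] du by simp
  \<comment> \<open>The input is 1 with \<open>n\<close> copies of 0.59. Its first term alone is at
    least 0.41 * 0.43 = 0.1763, above 0.171.\<close>
  moreover have "(1 - 59 / 100) * (1 - Q Eu n) + 1 * X Eu (price_above f 1) n < 171 / 1000"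
    unfolding Eu_def by (rule loss) auto
  ultimately show False using Xnn[OF E(2), of "price_above f 1" n] by argo
qed

end
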